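(* Consider a discrete Nash equilibrium problem satisfying the following. The feasible set is a non-empty, bounded box $X=\{\mathbf{x}\in\mathbb{R}^n : \mathbf{l}\le \mathbf{x}\le \mathbf{u}\}$ with $\mathbf{l},\mathbf{u}\in\mathbb{Z}^n$. For each player $\nu$, $$\theta_\nu(x^\nu,\mathbf{x}^{-\nu})=\theta^P_\nu(x^\nu)+\Theta^O_\nu(\mathbf{x}^{-\nu})^T x^\nu,\qquad \theta^P_\nu(x^\nu)=\sum_{i=1}^{n_\nu}\vartheta^P_{\nu,i}(x^\nu_i)+\tfrac12 (x^\nu)^T Q^\nu x^\nu,$$ where $\vartheta^P_{\nu,i}:\mathbb{R}\to\mathbb{R}$ for all $i$, $Q^\nu$ is a real $n_\nu\times n_\nu$ matrix, and $\Theta^O_\nu:\mathbb{R}^{n-n_\nu}\to\mathbb{R}^{n_\nu}$ is an operator each of whose components is a convex function or a concave function. Moreover, there is a partition of the set of variable indices $\{(\nu,i): 1\le\nu\le N,\ 1\le i\le n_\nu\}$ into two groups $G_1,G_2$ such that for all $\mathbf{x}\in X$ and all $(\nu,i)\ne(\mu,j)$: $$\frac{\partial F^\nu_i(\mathbf{x})}{\partial x^\mu_j}\le 0\ \text{ if } (\nu,i),(\mu,j) \text{ belong to the same group},\qquad \frac{\partial F^\nu_i(\mathbf{x})}{\partial x^\mu_j}\ge 0\ \text{ if they belong to different groups}.$$ Run the Jacobi-type method (described in the context) from the starting point $\mathbf{x}^0$ given by $x^{0,\nu}_i:=l^\nu_i$ if $(\nu,i)\in G_1$ and $x^{0,\nu}_i:=u^\nu_i$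 if $(\nu,i)\in G_2$, and suppose that there is a finite positive integer $h$ such that $\nu\in\bigcup_{t=k}^{k+h}\mathcal{J}^t$ for each player $\nu$ and each iterate $k$. Then, for each iterate $k$ and each player $\nu\in\mathcal{J}^k$, a best response $\hat x^{k,\nu}\in\hat x^\nu(\mathbf{x}^{k,-\nu})$ can be chosen such that $$\hat x^{k,\nu}_i\ge x^{k,\nu}_i\ \ \text{for all } i \text{ with } (\nu,i)\in G_1,\qquad \hat x^{k,\nu}_i\le x^{k,\nu}_i\ \ \text{for all } i \text{ with } (\nu,i)\in G_2 \qquad (\ast)$$ (where the iterates up to $k$ have been generated with best responses chosen so as to satisfy $(\ast)$). If for all $k$ and all $\nu\in\mathcal{J}^k$ the best response $\hat x^{k,\nu}$ is chosen such that $(\ast)$ holds, then the Jacobi-type method converges in a finite number of iterations to a solution of the discrete Nash equilibrium problem.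
   Context: There are $N$ players; player $\nu$ controls $x^\nu\in\mathbb{R}^{n_\nu}$; $n=n_1+\dots+n_N$, $\mathbf{x}=(x^1,\dots,x^N)=(x^\nu,\mathbf{x}^{-\nu})\in\mathbb{R}^n$, where $\mathbf{x}^{-\nu}$ collects the variables of all players other than $\nu$. Components of $\mathbf{l},\mathbf{u}$ are indexed in the same way ($l^\nu_i$, $u^\nu_i$). $X=\prod_\nu X^\nu$ with $X^\nu\subseteq\mathbb{R}^{n_\nu}$ the feasible set of player $\nu$ before integrality (here $X^\nu=\{x^\nu : l^\nu\le x^\nu\le u^\nu\}$). In the discrete Nash equilibrium problem (NEP) each player $\nu$ solves $\min_{x^\nu}\theta_\nu(x^\nu,\mathbf{x}^{-\nu})$ subject to $x^\nu\in X^\nu\cap\mathbb{Z}^{n_\nu}$, where $\theta_\nu:\mathbb{R}^n\to\mathbb{R}$. A solution (equilibrium) is a point $\mathbf{x}_*\in X\cap\mathbb{Z}^n$ such that for all $\nu$, $\theta_\nu(x^\nu_*,\mathbf{x}^{-\nu}_* )\le\theta_\nu(x^\nu,\mathbf{x}^{-\nu}_* )$ for all $x^\nu\in X^\nu\cap\mathbb{Z}^{n_\nu}$. Standing assumptions: each $\theta_\nu$ is continuously differentiable and is convex as a function of $x^\nu$ alone. $F^\nu(\mathbf{x}):=\nabla_{x^\nu}\theta_\nu(\mathbf{x})$, with components $F^\nu_i$; the partial derivatives of $F^\nu_i$ appearing in the statement are assumed to exist. Best response set: $\hat x^\nu(\mathbf{x}^{-\nu}):=\arg\min_{x^\nu\in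 X^\nu\cap\mathbb{Z}^{n_\nu}}\theta_\nu(x^\nu,\mathbf{x}^{-\nu})$. Jacobi-type method: (S.0) choose a starting point $\mathbf{x}^0\in X\cap\mathbb{Z}^n$ and set $k:=0$. (S.1) If $\mathbf{x}^k$ is a solution of the discrete NEP then stop. (S.2) Choose a subset $\mathcal{J}^k$ of the players; for each $\nu\in\mathcal{J}^k$ compute a best response $\hat x^{k,\nu}\in\hat x^\nu(\mathbf{x}^{k,-\nu})$. (S.3) For all $\nu\in\mathcal{J}^k$ set $x^{k+1,\nu}:=\hat x^{k,\nu}$, and for all $\nu\notin\mathcal{J}^k$ set $x^{k+1,\nu}:=x^{k,\nu}$; set $k:=k+1$ and go to (S.1). *)

theory Defs
  imports "HOL-Analysis.Analysis"
begin

text \<open>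
  The pairs (player, coordinate) of the paper are the elements of a finite type \<open>'v\<close>, and the
  players those of a finite type \<open>'p\<close>; \<open>own v\<close> is the player who controls the variable \<open>v\<close>. Thus
  \<open>real ^ 'v\<close> is the joint strategy space, and player \<open>\<nu>\<close>'s block \<open>{v. own v = \<nu>}\<close> may be of any
  size. A strategy of player \<open>\<nu>\<close> is given by a vector \<open>y :: real ^ 'v\<close> of which only the components
  in the block of \<open>\<nu>\<close> are ever used. Similarly, a function of \<open>\<nu>\<close>'s variables alone is a function
  on \<open>real ^ 'v\<close> that ignores the remaining components.
\<close>

text \<open>The joint strategy whose \<open>\<nu>\<close>-block is that of \<open>y\<close> and whose other blocks are those of \<open>x\<close>.\<close>

definition joint :: "('v::finite \<Rightarrow> 'p::finite) \<Rightarrow> 'p \<Rightarrow> real ^ 'v \<Rightarrow> real ^ 'v \<Rightarrow> real ^ 'v"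
  where "joint own \<nu> y x = (\<chi> v. if own v = \<nu> then y $ v else x $ v)"

definition integer_points :: "(real ^ 'v::finite) set"
  where "integer_points = {x. \<forall>v. x $ v \<in> \<int>}"

definition feasible_strategies ::
    "('v::finite \<Rightarrow> 'p::finite) \<Rightarrow> real ^ 'v \<Rightarrow> real ^ 'v \<Rightarrow> 'p \<Rightarrow> (real ^ 'v) set"
  where "feasible_strategies own l u \<nu> =
    {y. \<forall>v. own v = \<nu> \<longrightarrow> l $ v \<le> y $ v \<and> y $ v \<le> u $ v \<and> y $ v \<in> \<int>}"

definition best_responses ::
    "('v::finite \<Rightarrow> 'p::finite) \<Rightarrow> real ^ 'v \<Rightarrow> real ^ 'v \<Rightarrow> ('p \<Rightarrow> real ^ 'v \<Rightarrow> real) \<Rightarrow>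
     'p \<Rightarrow> real ^ 'v \<Rightarrow> (real ^ 'v) set"
  where "best_responses own l u \<theta> \<nu> x =
    {y \<in> feasible_strategies own l u \<nu>.
       \<forall>z \<in> feasible_strategies own l u \<nu>. \<theta> \<nu> (joint own \<nu> y x) \<le> \<theta> \<nu> (joint own \<nu> z x)}"

definition discrete_equilibrium ::
    "('v::finite \<Rightarrow> 'p::finite) \<Rightarrow> real ^ 'v \<Rightarrow> real ^ 'v \<Rightarrow> ('p \<Rightarrow> real ^ 'v \<Rightarrow> real) \<Rightarrow>
     real ^ 'v \<Rightarrow> bool"
  where "discrete_equilibrium own l u \<theta> x \<longleftrightarrow>
    x \<in> cbox l u \<inter> integer_points \<and>
    (\<forall>\<nu>. \<forall>y \<in> feasible_strategies own l u \<nu>. \<theta> \<nu> x \<le> \<theta> \<nu> (joint own \<nu> y x))"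

definition continuously_differentiable :: "(real ^ 'v::finite \<Rightarrow> real) \<Rightarrow> bool"
  where "continuously_differentiable f \<longleftrightarrow>
    (\<exists>G. continuous_on UNIV G \<and> (\<forall>x. GDERIV f x :> G x))"

definition partially_differentiable :: "(real ^ 'v::finite \<Rightarrow> real) \<Rightarrow> 'v \<Rightarrow> real ^ 'v \<Rightarrow> bool"
  where "partially_differentiable f w x \<longleftrightarrow>
    (\<lambda>t. f (x + t *\<^sub>R axis w 1)) field_differentiable (at 0)"

definition partial_deriv :: "(real ^ 'v::finite \<Rightarrow> real) \<Rightarrow> 'v \<Rightarrow> real ^ 'v \<Rightarrow> real"
  where "partial_deriv f w x = deriv (\<lambda>t. f (x + t *\<^sub>R axis w 1)) 0"

text \<open>The component at \<open>v\<close> of the gradient of player \<open>own v\<close>'s cost in that player's own variables.\<close>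

definition game_map ::
    "('v::finite \<Rightarrow> 'p::finite) \<Rightarrow> ('p \<Rightarrow> real ^ 'v \<Rightarrow> real) \<Rightarrow> 'v \<Rightarrow> real ^ 'v \<Rightarrow> real"
  where "game_map own \<theta> v x = partial_deriv (\<theta> (own v)) v x"

text \<open>Only the entries of \<open>Q \<nu>\<close> with both indices in the block of \<open>\<nu>\<close> enter.\<close>

definition private_cost ::
    "('v::finite \<Rightarrow> 'p::finite) \<Rightarrow> ('v \<Rightarrow> real \<Rightarrow> real) \<Rightarrow> ('p \<Rightarrow> real ^ 'v ^ 'v) \<Rightarrow>
     'p \<Rightarrow> real ^ 'v \<Rightarrow> real"
  where "private_cost own \<phi> Q \<nu> x =
    (\<Sum>v | own v = \<nu>. \<phi> v (x $ v)) +
    1 / 2 * (\<Sum>v | own v = \<nu>. \<Sum>w | own w = \<nu>. x $ v * (Q \<nu> $ v $ w) * x $ w)"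

text \<open>
  Step \<open>k\<close> of the Jacobi-type method (S.2 and S.3): \<open>x\<close> is the sequence of iterates, \<open>J k\<close> the set of
  players that move, and \<open>xh k \<nu>\<close> the best response computed for \<open>\<nu> \<in> J k\<close>.
\<close>

definition jacobi_step ::
    "('v::finite \<Rightarrow> 'p::finite) \<Rightarrow> real ^ 'v \<Rightarrow> real ^ 'v \<Rightarrow> ('p \<Rightarrow> real ^ 'v \<Rightarrow> real) \<Rightarrow>
     (nat \<Rightarrow> 'p set) \<Rightarrow> (nat \<Rightarrow> real ^ 'v) \<Rightarrow> (nat \<Rightarrow> 'p \<Rightarrow> real ^ 'v) \<Rightarrow> nat \<Rightarrow> bool"
  where "jacobi_step own l u \<theta> J x xh k \<longleftrightarrow>
    (\<forall>\<nu> \<in> J k. xh k \<nu> \<in> best_responses own l u \<theta> \<nu> (x k)) \<and>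
    x (Suc k) = (\<chi> v. if own v \<in> J k then xh k (own v) $ v else x k $ v)"

text \<open>
  The method performs steps \<open>0, \<dots>, K - 1\<close> without having stopped before and so generates the
  iterates \<open>x 0, \<dots>, x K\<close>; later values of the sequences are irrelevant.
\<close>

definition jacobi_run ::
    "('v::finite \<Rightarrow> 'p::finite) \<Rightarrow> real ^ 'v \<Rightarrow> real ^ 'v \<Rightarrow> ('p \<Rightarrow> real ^ 'v \<Rightarrow> real) \<Rightarrow>
     (nat \<Rightarrow> 'p set) \<Rightarrow> (nat \<Rightarrow> real ^ 'v) \<Rightarrow> (nat \<Rightarrow> 'p \<Rightarrow> real ^ 'v) \<Rightarrow> nat \<Rightarrow> bool"
  where "jacobi_run own l u \<theta> J x xh K \<longleftrightarrow>
    x 0 \<in> cbox l u \<inter> integer_points \<and>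
    (\<forall>k<K. \<not> discrete_equilibrium own l u \<theta> (x k) \<and> jacobi_step own l u \<theta> J x xh k)"

definition monotone_move ::
    "('v::finite \<Rightarrow> 'p::finite) \<Rightarrow> 'v set \<Rightarrow> 'v set \<Rightarrow> 'p \<Rightarrow> real ^ 'v \<Rightarrow> real ^ 'v \<Rightarrow> bool"
  where "monotone_move own G1 G2 \<nu> x y \<longleftrightarrow>
    (\<forall>v. own v = \<nu> \<longrightarrow> (v \<in> G1 \<longrightarrow> x $ v \<le> y $ v) \<and> (v \<in> G2 \<longrightarrow> y $ v \<le> x $ v))"

end

theory Submission
  imports Defs
begin

text \<open>
  Give each variable the sign \<open>+1\<close> if it lies in \<open>G1\<close> and \<open>-1\<close> if it lies in \<open>G2\<close>, and order joint
  strategies componentwise after multiplication by these signs. The two sign conditions on the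
  partial derivatives of the game map then become one: each component \<open>F v\<close>, taken with its sign,
  decreases along the order in all variables other than \<open>v\<close>. By the mean value theorem this says that
  raising variables of player \<open>\<nu>\<close> costs \<open>\<nu>\<close> less (or saves more) the higher all the other variables
  are: in this order the game is one with strategic complements (\<open>decreasing_increments_set\<close>).

  The starting point is the least point of the box. Suppose that the run has been increasing so far
  and that \<open>\<nu>\<close> is about to move. Either \<open>\<nu>\<close> has never moved, and any best response lies above the
  current block; or the current block was a best response to an earlier, hence lower, iterate. In the
  second case the join of the current block with any best response is again a best response, by the
  exchange argument of supermodular games (\<open>best_response_above\<close>).

  A run of increasing moves is an increasing sequence in the finite set of integer points of the box,
  so it becomes constant unless it stops earlier. While it is constant every player moves at least
  once, so that every player's block is a best response to the constant point, which is therefore an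
  equilibrium (\<open>constant_window_equilibrium\<close>).
\<close>

section \<open>Strategic complements from the signs of the partial derivatives\<close>

definition signed_le :: "('v::finite \<Rightarrow> real) \<Rightarrow> real ^ 'v \<Rightarrow> real ^ 'v \<Rightarrow> bool"
  where "signed_le s a b \<longleftrightarrow> (\<forall>v. s v * a $ v \<le> s v * b $ v)"

definition override :: "'v::finite set \<Rightarrow> real ^ 'v \<Rightarrow> real ^ 'v \<Rightarrow> real ^ 'v"
  where "override S c b = (\<chi> v. if v \<in> S then c $ v else b $ v)"

lemma override_nth [simp]: "override S c b $ v = (if v \<in> S then c $ v else b $ v)"
  by (simp add: override_def)

lemma joint_nth [simp]: "joint own \<nu> y x $ v = (if own v = \<nu> then y $ v else x $ v)"
  by (simp add: joint_def)

lemma joint_self [simp]: "joint own \<nu> x x = x"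
  by (simp add: vec_eq_iff)

lemma override_in_cbox: "b \<in> cbox l u \<Longrightarrow> c \<in> cbox l u \<Longrightarrow> override S c b \<in> cbox l u"
  by (simp add: mem_box_cart)

lemma override_insert:
  assumes "w \<notin> S"
  shows "override (insert w S) c b = override S c b + (c $ w - b $ w) *\<^sub>R axis w 1"
  using assms by (auto simp: vec_eq_iff axis_def)

lemma continuously_differentiable_partially:
  assumes "continuously_differentiable f"
  shows "partially_differentiable f v x"
proof -
  obtain G where "\<And>x. GDERIV f x :> G x"
    using assms by (auto simp: continuously_differentiable_def)
  then have f: "(f has_derivative (\<lambda>h. h \<bullet> G x)) (at (x + 0 *\<^sub>R axis v 1))"
    by (simp add: gderiv_def)
  have "((\<lambda>t. x + t *\<^sub>R axis v 1) has_derivative (\<lambda>t. t *\<^sub>R axis v 1)) (at 0)"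
    by (auto intro!: derivative_eq_intros)
  then have "((\<lambda>t. f (x + t *\<^sub>R axis v 1)) has_derivative (\<lambda>t. (t *\<^sub>R axis v 1) \<bullet> G x)) (at 0)"
    by (rule has_derivative_compose) (rule f)
  then have "((\<lambda>t. f (x + t *\<^sub>R axis v 1)) has_real_derivative (axis v 1 \<bullet> G x)) (at 0)"
    by (simp add: has_field_derivative_def mult.commute[of _ "axis v 1 \<bullet> G x"] mult_commute_abs)
  then show ?thesis
    unfolding partially_differentiable_def using field_differentiable_def by blast
qed

lemma partial_deriv_along_axis:
  assumes "partially_differentiable f w (p + (r * t) *\<^sub>R axis w 1)"
  shows "((\<lambda>r. f (p + (r * t) *\<^sub>R axis w 1)) has_real_derivative
           t * partial_deriv f w (p + (r * t) *\<^sub>R axis w 1)) (at r)"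
proof -
  let ?q = "p + (r * t) *\<^sub>R axis w 1"
  have 1: "((\<lambda>t. f (?q + t *\<^sub>R axis w 1)) has_real_derivative partial_deriv f w ?q)
             (at ((r - r) * t))"
    using assms unfolding partially_differentiable_def partial_deriv_def
    by (simp add: DERIV_deriv_iff_field_differentiable)
  have 2: "((\<lambda>r'. (r' - r) * t) has_real_derivative t) (at r)"
    by (auto intro!: derivative_eq_intros)
  have 3: "((\<lambda>r'. f (?q + ((r' - r) * t) *\<^sub>R axis w 1)) has_real_derivative
              partial_deriv f w ?q * t) (at r)"
    using DERIV_chain2[OF 1 2] .
  have "?q + ((r' - r) * t) *\<^sub>R axis w 1 = p + (r' * t) *\<^sub>R axis w 1" for r'
    by (simp add: algebra_simps flip: scaleR_add_left)
  with 3 show ?thesis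
    by (simp only: mult.commute[of t])
qed

lemma segment_in_cbox:
  fixes p d :: "'a::euclidean_space"
  assumes "p \<in> cbox l u" "p + t *\<^sub>R d \<in> cbox l u" "0 \<le> r" "r \<le> 1"
  shows "p + (r * t) *\<^sub>R d \<in> cbox l u"
proof -
  have "(1 - r) *\<^sub>R p + r *\<^sub>R (p + t *\<^sub>R d) \<in> cbox l u"
    using assms by (intro convexD[OF convex_box(1)]) auto
  moreover have "(1 - r) *\<^sub>R p + r *\<^sub>R (p + t *\<^sub>R d) = p + (r * t) *\<^sub>R d"
    by (simp add: algebra_simps)
  ultimately show ?thesis by simp
qed

lemma signed_product_nonpos:
  fixes \<sigma> t d :: real
  assumes "\<bar>\<sigma>\<bar> = 1" "0 \<le> \<sigma> * t" "\<sigma> * d \<le> 0"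
  shows "t * d \<le> 0"
  using assms by (cases "\<sigma> \<ge> 0") (auto simp: mult_nonneg_nonpos mult_nonpos_nonneg)

lemma antitone_along_axis:
  assumes s: "\<bar>s w\<bar> = (1::real)"
    and diff: "\<And>x. x \<in> cbox l u \<Longrightarrow> partially_differentiable F w x"
    and sign: "\<And>x. x \<in> cbox l u \<Longrightarrow> s w * (c * partial_deriv F w x) \<le> 0"
    and p: "p \<in> cbox l u" "p + t *\<^sub>R axis w 1 \<in> cbox l u" and t: "0 \<le> s w * t"
  shows "c * F (p + t *\<^sub>R axis w 1) \<le> c * F p"
proof -
  let ?g = "\<lambda>r. c * F (p + (r * t) *\<^sub>R axis w 1)"
  have "?g 1 \<le> ?g 0"
  proof (rule DERIV_nonpos_imp_nonincreasing[where f = ?g])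
    fix r :: real
    assume "0 \<le> r" "r \<le> 1"
    then have r: "p + (r * t) *\<^sub>R axis w 1 \<in> cbox l u"
      using segment_in_cbox[OF p] by blast
    have "(?g has_real_derivative c * (t * partial_deriv F w (p + (r * t) *\<^sub>R axis w 1))) (at r)"
      by (intro DERIV_cmult partial_deriv_along_axis diff r)
    moreover have "t * (c * partial_deriv F w (p + (r * t) *\<^sub>R axis w 1)) \<le> 0"
      by (rule signed_product_nonpos[OF s t sign[OF r]])
    ultimately show "\<exists>y. (?g has_real_derivative y) (at r) \<and> y \<le> 0"
      by (metis mult.left_commute)
  qed simp
  then show ?thesis by simp
qed

text \<open>Two points that agree at \<open>v\<close> are joined by a path that moves the other coordinates one at a time.
  It stays in the box and never moves in direction \<open>v\<close>, so the hypotheses cover each of its pieces.\<close>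

lemma antitone_in_other_coordinates:
  assumes s: "\<And>w. \<bar>s w\<bar> = (1::real)"
    and diff: "\<And>x w. x \<in> cbox l u \<Longrightarrow> w \<noteq> v \<Longrightarrow> partially_differentiable F w x"
    and sign: "\<And>x w. x \<in> cbox l u \<Longrightarrow> w \<noteq> v \<Longrightarrow> s w * (c * partial_deriv F w x) \<le> 0"
    and ab: "a \<in> cbox l u" "b \<in> cbox l u" "signed_le s a b" and v: "a $ v = b $ v"
  shows "c * F b \<le> c * F a"
proof -
  have "c * F (override T b a) \<le> c * F a" if "finite T" "v \<notin> T" for T
    using that
  proof (induction T rule: finite_induct)
    case empty
    have "override {} b a = a" by (simp add: vec_eq_iff)
    then show ?case by simp
  next
    case (insert w T)
    have "c * F (override T b a + (b $ w - a $ w) *\<^sub>R axis w 1) \<le> c * F (override T b a)"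
    proof (rule antitone_along_axis[where s = s and l = l and u = u])
      show "override T b a + (b $ w - a $ w) *\<^sub>R axis w 1 \<in> cbox l u"
        using override_in_cbox[OF ab(1,2)] override_insert[OF insert.hyps(2)] by metis
      show "0 \<le> s w * (b $ w - a $ w)"
        using ab(3) by (simp add: signed_le_def algebra_simps)
    qed (use s diff sign insert.prems override_in_cbox[OF ab(1,2)] in auto)
    with insert show ?case
      by (simp add: override_insert)
  qed
  from this[of "- {v}"] have "c * F (override (- {v}) b a) \<le> c * F a"
    by simp
  moreover have "override (- {v}) b a = b"
    using v by (simp add: vec_eq_iff)
  ultimately show ?thesis by simp
qed

text \<open>The difference form of strategic complements: raising a variable in \<open>V\<close> by a given amount
  changes \<open>f\<close> by less at the higher of two points.\<close>

definition decreasing_increments ::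
    "('v::finite \<Rightarrow> real) \<Rightarrow> real ^ 'v \<Rightarrow> real ^ 'v \<Rightarrow> (real ^ 'v \<Rightarrow> real) \<Rightarrow> 'v set \<Rightarrow> bool"
  where "decreasing_increments s l u f V \<longleftrightarrow>
    (\<forall>v\<in>V. \<forall>a\<in>cbox l u. \<forall>b\<in>cbox l u. \<forall>t.
       signed_le s a b \<and> a $ v = b $ v \<and> 0 \<le> s v * t \<and>
       a + t *\<^sub>R axis v 1 \<in> cbox l u \<and> b + t *\<^sub>R axis v 1 \<in> cbox l u \<longrightarrow>
       f (b + t *\<^sub>R axis v 1) - f b \<le> f (a + t *\<^sub>R axis v 1) - f a)"

lemma decreasing_increments_from_partials:
  assumes s: "\<And>w. \<bar>s w\<bar> = (1::real)"
    and f: "\<And>x v. v \<in> V \<Longrightarrow> partially_differentiable f v x"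
    and diff: "\<And>x v w. x \<in> cbox l u \<Longrightarrow> v \<in> V \<Longrightarrow> w \<noteq> v \<Longrightarrow>
                 partially_differentiable (partial_deriv f v) w x"
    and sign: "\<And>x v w. x \<in> cbox l u \<Longrightarrow> v \<in> V \<Longrightarrow> w \<noteq> v \<Longrightarrow>
                 s w * (s v * partial_deriv (partial_deriv f v) w x) \<le> 0"
  shows "decreasing_increments s l u f V"
  unfolding decreasing_increments_def
proof (intro ballI allI impI)
  fix v a b t
  assume v: "v \<in> V" and ab: "a \<in> cbox l u" "b \<in> cbox l u"
    and *: "signed_le s a b \<and> a $ v = b $ v \<and> 0 \<le> s v * t \<and>
       a + t *\<^sub>R axis v 1 \<in> cbox l u \<and> b + t *\<^sub>R axis v 1 \<in> cbox l u"
  let ?P = "\<lambda>p r. p + (r * t) *\<^sub>R axis v 1"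
  let ?g = "\<lambda>r. f (?P b r) - f (?P a r)"
  have "?g 1 \<le> ?g 0"
  proof (rule DERIV_nonpos_imp_nonincreasing[where f = ?g])
    fix r :: real
    assume r: "0 \<le> r" "r \<le> 1"
    have in_box: "?P a r \<in> cbox l u" "?P b r \<in> cbox l u"
      using segment_in_cbox ab * r by blast+
    have "s v * partial_deriv f v (?P b r) \<le> s v * partial_deriv f v (?P a r)"
    proof (rule antitone_in_other_coordinates[where s = s and l = l and u = u and v = v])
      show "signed_le s (?P a r) (?P b r)"
        using * by (simp add: signed_le_def algebra_simps)
    qed (use s diff sign v in_box * in auto)
    then have "s v * (partial_deriv f v (?P b r) - partial_deriv f v (?P a r)) \<le> 0"
      by (simp add: algebra_simps)
    then have "t * (partial_deriv f v (?P b r) - partial_deriv f v (?P a r)) \<le> 0"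
      using signed_product_nonpos[OF s] * by blast
    moreover have "(?g has_real_derivative
        t * partial_deriv f v (?P b r) - t * partial_deriv f v (?P a r)) (at r)"
      by (intro DERIV_diff partial_deriv_along_axis f v)
    ultimately show "\<exists>y. (?g has_real_derivative y) (at r) \<and> y \<le> 0"
      by (auto simp: right_diff_distrib)
  qed simp
  then show "f (b + t *\<^sub>R axis v 1) - f b \<le> f (a + t *\<^sub>R axis v 1) - f a"
    by simp
qed

text \<open>Raising the variables in \<open>S\<close> one after the other keeps the two points comparable and equal on
  \<open>S\<close>, so the one-variable inequalities add up.\<close>

lemma decreasing_increments_set:
  assumes di: "decreasing_increments s l u f V" and S: "S \<subseteq> V"
    and box: "a \<in> cbox l u" "b \<in> cbox l u" "c \<in> cbox l u" and le: "signed_le s a b"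
    and eq: "\<And>v. v \<in> S \<Longrightarrow> a $ v = b $ v"
    and up: "\<And>v. v \<in> S \<Longrightarrow> s v * a $ v \<le> s v * c $ v"
  shows "f (override S c b) - f b \<le> f (override S c a) - f a"
proof -
  have "finite S" by simp
  then show ?thesis using S eq up
  proof (induction S rule: finite_induct)
    case empty
    have "override {} c x = x" for x by (simp add: vec_eq_iff)
    then show ?case by simp
  next
    case (insert w T)
    let ?a = "override T c a" and ?b = "override T c b" and ?d = "(c $ w - a $ w) *\<^sub>R axis w 1"
    have steps: "override (insert w T) c a = ?a + ?d" "override (insert w T) c b = ?b + ?d"
      using insert by (simp_all add: override_insert)
    have "f (?b + ?d) - f ?b \<le> f (?a + ?d) - f ?a"
    proof (rule di[unfolded decreasing_increments_def, rule_format])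
      show "w \<in> V" using insert.prems by simp
      have "signed_le s ?a ?b" using le by (simp add: signed_le_def)
      moreover have "?a $ w = ?b $ w" using insert.prems by simp
      moreover have "0 \<le> s w * (c $ w - a $ w)"
        using insert.prems(3)[of w] by (simp add: algebra_simps)
      moreover have "?a + ?d \<in> cbox l u" "?b + ?d \<in> cbox l u"
        using override_in_cbox box steps by metis+
      ultimately show "signed_le s ?a ?b \<and> ?a $ w = ?b $ w \<and> 0 \<le> s w * (c $ w - a $ w) \<and>
          ?a + ?d \<in> cbox l u \<and> ?b + ?d \<in> cbox l u"
        by blast
    qed (use override_in_cbox box in blast)+
    moreover have "f ?b - f b \<le> f ?a - f a"
      using insert by simp
    ultimately show ?case
      unfolding steps by linarith
  qed
qed

section \<open>Best responses\<close>

lemma finite_integer_box: "finite (cbox l u \<inter> integer_points)"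
proof -
  let ?I = "\<lambda>v. {r. l $ v \<le> r \<and> r \<le> u $ v \<and> r \<in> \<int>}"
  have fin: "finite (?I v)" for v
  proof (rule finite_subset)
    show "?I v \<subseteq> of_int ` {\<lceil>l $ v\<rceil>..\<lfloor>u $ v\<rfloor>}"
      by (auto elim!: Ints_cases simp: ceiling_le_iff le_floor_iff)
  qed simp
  have "finite (vec_lambda ` (PiE UNIV ?I))"
    using fin by (intro finite_imageI finite_PiE) auto
  moreover have "cbox l u \<inter> integer_points \<subseteq> vec_lambda ` (PiE UNIV ?I)"
  proof
    fix x assume "x \<in> cbox l u \<inter> integer_points"
    then have "vec_nth x \<in> PiE UNIV ?I"
      by (auto simp: mem_box_cart integer_points_def)
    then have "vec_lambda (vec_nth x) \<in> vec_lambda ` (PiE UNIV ?I)"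
      by (rule imageI)
    then show "x \<in> vec_lambda ` (PiE UNIV ?I)"
      by simp
  qed
  ultimately show ?thesis
    using finite_subset by blast
qed

lemma own_block_feasible:
  "x \<in> cbox l u \<inter> integer_points \<Longrightarrow> x \<in> feasible_strategies own l u \<nu>"
  by (simp add: feasible_strategies_def mem_box_cart integer_points_def)

lemma joint_in_integer_box:
  assumes "y \<in> feasible_strategies own l u \<nu>" "x \<in> cbox l u \<inter> integer_points"
  shows "joint own \<nu> y x \<in> cbox l u \<inter> integer_points"
  using assms by (auto simp: feasible_strategies_def mem_box_cart integer_points_def)

lemma best_response_block_cong:
  assumes "y \<in> best_responses own l u \<theta> \<nu> x" "\<And>v. own v = \<nu> \<Longrightarrow> z $ v = y $ v"
  shows "z \<in> best_responses own l u \<theta> \<nu> x"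
proof -
  have "joint own \<nu> z x = joint own \<nu> y x"
    using assms(2) by (simp add: vec_eq_iff)
  then show ?thesis
    using assms by (auto simp: best_responses_def feasible_strategies_def)
qed

lemma best_response_exists:
  assumes x: "x \<in> cbox l u \<inter> integer_points"
  shows "\<exists>y. y \<in> best_responses own l u \<theta> \<nu> x"
proof -
  let ?F = "feasible_strategies own l u \<nu>" and ?c = "\<lambda>y. \<theta> \<nu> (joint own \<nu> y x)"
  (* The strategies themselves form an infinite set, as their entries outside the block are free. *)
  have "finite ((\<lambda>y. joint own \<nu> y x) ` ?F)"
    by (rule finite_subset[OF _ finite_integer_box[of l u]]) (use joint_in_integer_box x in blast)
  then have "finite (?c ` ?F)"
    using finite_imageI[of "(\<lambda>y. joint own \<nu> y x) ` ?F" "\<theta> \<nu>"] by (simp add: image_image)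
  moreover have "?F \<noteq> {}"
    using own_block_feasible[OF x] by blast
  ultimately have min: "Min (?c ` ?F) \<in> ?c ` ?F" "\<And>z. z \<in> ?F \<Longrightarrow> Min (?c ` ?F) \<le> ?c z"
    by auto
  then obtain y where "y \<in> ?F" "Min (?c ` ?F) = ?c y"
    by blast
  with min(2) show ?thesis
    by (auto simp: best_responses_def)
qed

lemma best_response_if_no_worse:
  assumes y: "y \<in> best_responses own l u \<theta> \<nu> x" and z: "z \<in> feasible_strategies own l u \<nu>"
    and le: "\<theta> \<nu> (joint own \<nu> z x) \<le> \<theta> \<nu> (joint own \<nu> y x)"
  shows "z \<in> best_responses own l u \<theta> \<nu> x"
  using assms by (force simp: best_responses_def)

text \<open>
  If the block of \<open>x\<close> was optimal against the lower point \<open>x'\<close>, lowering it to its meet with \<open>y\<close> did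
  not pay there. Raising that meet back to \<open>x\<close> and raising \<open>y\<close> to its join with \<open>x\<close> change the same
  variables by the same amounts, the latter at a higher point. So, by strategic complements, replacing
  the best response \<open>y\<close> by the join does not cost anything.
\<close>

lemma best_response_above:
  assumes di: "decreasing_increments s l u (\<theta> \<nu>) {v. own v = \<nu>}"
    and x: "x \<in> cbox l u \<inter> integer_points" and x': "x' \<in> cbox l u \<inter> integer_points"
    and le: "signed_le s x' x" and opt: "x \<in> best_responses own l u \<theta> \<nu> x'"
  shows "\<exists>y\<in>best_responses own l u \<theta> \<nu> x. \<forall>v. own v = \<nu> \<longrightarrow> s v * x $ v \<le> s v * y $ v"
proof -
  obtain y where y: "y \<in> best_responses own l u \<theta> \<nu> x"
    using best_response_exists[OF x] by blast
  then have yF: "y \<in> feasible_strategies own l u \<nu>"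
    by (simp add: best_responses_def)
  have xF: "x \<in> feasible_strategies own l u \<nu>"
    by (rule own_block_feasible[OF x])
  define S where "S = {v. own v = \<nu> \<and> s v * y $ v \<le> s v * x $ v}"
  let ?join = "override S x y" and ?meet = "override S y x"
  have meetF: "?meet \<in> feasible_strategies own l u \<nu>"
    and joinF: "?join \<in> feasible_strategies own l u \<nu>"
    using xF yF by (auto simp: feasible_strategies_def)
  let ?a = "joint own \<nu> ?meet x'" and ?b = "joint own \<nu> y x"
  have "\<theta> \<nu> (override S x ?b) - \<theta> \<nu> ?b \<le> \<theta> \<nu> (override S x ?a) - \<theta> \<nu> ?a"
  proof (rule decreasing_increments_set[OF di])
    show "?a \<in> cbox l u" "?b \<in> cbox l u"
      using joint_in_integer_box meetF yF x x' by blast+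
    show "signed_le s ?a ?b"
      using le by (auto simp: signed_le_def S_def)
  qed (use x in \<open>auto simp: S_def\<close>)
  moreover have "override S x ?b = joint own \<nu> ?join x" "override S x ?a = joint own \<nu> x x'"
    by (auto simp: vec_eq_iff S_def)
  moreover have "\<theta> \<nu> (joint own \<nu> x x') \<le> \<theta> \<nu> ?a"
    using opt meetF by (simp add: best_responses_def)
  ultimately have "\<theta> \<nu> (joint own \<nu> ?join x) \<le> \<theta> \<nu> ?b"
    by simp
  then have "?join \<in> best_responses own l u \<theta> \<nu> x"
    by (rule best_response_if_no_worse[OF y joinF])
  moreover have "\<forall>v. own v = \<nu> \<longrightarrow> s v * x $ v \<le> s v * ?join $ v"
    by (auto simp: S_def)
  ultimately show ?thesis by blast
qed

section \<open>Increasing runs of the method\<close>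

lemma jacobi_step_in_integer_box:
  assumes "jacobi_step own l u \<theta> J x xh k" "x k \<in> cbox l u \<inter> integer_points"
  shows "x (Suc k) \<in> cbox l u \<inter> integer_points"
  using assms
  by (auto simp: jacobi_step_def best_responses_def feasible_strategies_def mem_box_cart
      integer_points_def)

lemma jacobi_step_signed_le:
  assumes "jacobi_step own l u \<theta> J x xh k"
    and "\<And>\<nu> v. \<nu> \<in> J k \<Longrightarrow> own v = \<nu> \<Longrightarrow> s v * x k $ v \<le> s v * xh k \<nu> $ v"
  shows "signed_le s (x k) (x (Suc k))"
  using assms by (simp add: jacobi_step_def signed_le_def)

text \<open>What a player's block looks like at any time is decided by the player's last move.\<close>

lemma block_untouched_or_best_response:
  assumes "\<And>j. j < k \<Longrightarrow> jacobi_step own l u \<theta> J x xh j"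
  shows "(\<forall>v. own v = \<nu> \<longrightarrow> x k $ v = x 0 $ v) \<or>
         (\<exists>j<k. x k \<in> best_responses own l u \<theta> \<nu> (x j))"
  using assms
proof (induction k)
  case 0
  show ?case by simp
next
  case (Suc k)
  have step: "jacobi_step own l u \<theta> J x xh k"
    using Suc.prems by blast
  show ?case
  proof (cases "\<nu> \<in> J k")
    case True
    then have "xh k \<nu> \<in> best_responses own l u \<theta> \<nu> (x k)"
      using step by (simp add: jacobi_step_def)
    then have "x (Suc k) \<in> best_responses own l u \<theta> \<nu> (x k)"
      by (rule best_response_block_cong) (use step True in \<open>simp add: jacobi_step_def\<close>)
    then show ?thesis by blast
  next
    case False
    then have same: "x (Suc k) $ v = x k $ v" if "own v = \<nu>" for v
      using step that by (simp add: jacobi_step_def)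
    have "(\<forall>v. own v = \<nu> \<longrightarrow> x k $ v = x 0 $ v) \<or>
         (\<exists>j<k. x k \<in> best_responses own l u \<theta> \<nu> (x j))"
      using Suc by simp
    then show ?thesis
      using same best_response_block_cong less_SucI by (metis (no_types, lifting))
  qed
qed

lemma signed_le_trans: "signed_le s a b \<Longrightarrow> signed_le s b c \<Longrightarrow> signed_le s a c"
  unfolding signed_le_def using order_trans by blast

lemma signed_le_chain:
  assumes "\<And>j. j < k \<Longrightarrow> signed_le s (x j) (x (Suc j))" "i \<le> k"
  shows "signed_le s (x i) (x k)"
  using assms(2,1)
proof (induction rule: dec_induct)
  case base
  show ?case by (simp add: signed_le_def)
next
  case (step n)
  then show ?case by (meson less_SucI lessI signed_le_trans)
qed

text \<open>The signed sum of the components is a strictly increasing potential: it takes its largest value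
  on the sequence at some point, and the sequence cannot move after that.\<close>

lemma increasing_sequence_eventually_constant:
  assumes s: "\<And>v. s v \<noteq> 0" and fin: "finite (range x)"
    and le: "\<And>k. signed_le s (x k) (x (Suc k))"
  shows "\<exists>k. \<forall>m\<ge>k. x m = x k"
proof -
  let ?\<Phi> = "\<lambda>a. \<Sum>v\<in>UNIV. s v * a $ v"
  let ?R = "range (\<lambda>m. ?\<Phi> (x m))"
  have "finite ?R"
    using finite_imageI[OF fin, of ?\<Phi>] by (simp add: image_image)
  then have "Max ?R \<in> ?R" and Max: "\<And>m. ?\<Phi> (x m) \<le> Max ?R"
    by auto
  then obtain k where "Max ?R = ?\<Phi> (x k)"
    by blast
  with Max have max: "\<And>m. ?\<Phi> (x m) \<le> ?\<Phi> (x k)"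
    by simp
  have "x m = x k" if "m \<ge> k" for m
  proof -
    have km: "signed_le s (x k) (x m)"
      using signed_le_chain le that by blast
    have "?\<Phi> (x m) = ?\<Phi> (x k)"
    proof (rule antisym[OF max])
      show "?\<Phi> (x k) \<le> ?\<Phi> (x m)"
        using km by (intro sum_mono) (simp add: signed_le_def)
    qed
    then have "(\<Sum>v\<in>UNIV. s v * x m $ v - s v * x k $ v) = 0"
      by (simp add: sum_subtractf)
    moreover have "\<And>v. 0 \<le> s v * x m $ v - s v * x k $ v"
      using km by (simp add: signed_le_def)
    ultimately have "\<forall>v. s v * x m $ v - s v * x k $ v = 0"
      by (subst (asm) sum_nonneg_eq_0_iff) auto
    then show ?thesis
      using s by (simp add: vec_eq_iff)
  qed
  then show ?thesis by blast
qed

lemma constant_window_equilibrium: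
  assumes x: "p \<in> cbox l u \<inter> integer_points"
    and moves: "\<And>\<nu>. \<exists>t. \<nu> \<in> J t \<and> jacobi_step own l u \<theta> J x xh t \<and> x t = p \<and> x (Suc t) = p"
  shows "discrete_equilibrium own l u \<theta> p"
proof -
  have "p \<in> best_responses own l u \<theta> \<nu> p" for \<nu>
  proof -
    obtain t where t: "\<nu> \<in> J t" "jacobi_step own l u \<theta> J x xh t" "x t = p" "x (Suc t) = p"
      using moves by blast
    then have step: "p = (\<chi> v. if own v \<in> J t then xh t (own v) $ v else p $ v)"
      and "xh t \<nu> \<in> best_responses own l u \<theta> \<nu> p"
      by (auto simp: jacobi_step_def)
    then show ?thesis
    proof (rule_tac best_response_block_cong)
      fix v assume "own v = \<nu>"
      with t(1) show "p $ v = xh t \<nu> $ v"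
        by (subst step) simp
    qed
  qed
  then show ?thesis
    using x by (simp add: discrete_equilibrium_def best_responses_def)
qed

section \<open>Convergence of the Jacobi-type method\<close>

theorem theorem4p4:
  fixes own :: "'v::finite \<Rightarrow> 'p::finite"
    and l u x0 :: "real ^ 'v"
    and \<theta> :: "'p \<Rightarrow> real ^ 'v \<Rightarrow> real"
    and \<phi> :: "'v \<Rightarrow> real \<Rightarrow> real"
    and Q :: "'p \<Rightarrow> real ^ 'v ^ 'v"
    and \<Theta> :: "'p \<Rightarrow> real ^ 'v \<Rightarrow> real ^ 'v"
    and G1 G2 :: "'v set"
    and J :: "nat \<Rightarrow> 'p set"
    and h :: nat
  assumes C1: "\<And>\<nu>. continuously_differentiable (\<theta> \<nu>)"
    and convex_own: "\<And>\<nu> x. convex_on UNIV (\<lambda>y. \<theta> \<nu> (joint own \<nu> y x))"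
    and integer_bounds: "l \<in> integer_points" "u \<in> integer_points"
    and nonempty: "cbox l u \<noteq> {}"
    and cost: "\<And>\<nu> x. \<theta> \<nu> x = private_cost own \<phi> Q \<nu> x + (\<Sum>v | own v = \<nu>. \<Theta> \<nu> x $ v * x $ v)"
    and others_only: "\<And>\<nu> x y. \<Theta> \<nu> (joint own \<nu> y x) = \<Theta> \<nu> x"
    and convex_or_concave: "\<And>\<nu> v. own v = \<nu> \<Longrightarrow>
          convex_on UNIV (\<lambda>x. \<Theta> \<nu> x $ v) \<or> concave_on UNIV (\<lambda>x. \<Theta> \<nu> x $ v)"
    and groups: "G1 \<union> G2 = UNIV" "G1 \<inter> G2 = {}"
    and partials_exist: "\<And>x v w. x \<in> cbox l u \<Longrightarrow> v \<noteq> w \<Longrightarrow>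
          partially_differentiable (game_map own \<theta> v) w x"
    and same_group: "\<And>x v w. x \<in> cbox l u \<Longrightarrow> v \<noteq> w \<Longrightarrow>
          (v \<in> G1 \<and> w \<in> G1) \<or> (v \<in> G2 \<and> w \<in> G2) \<Longrightarrow>
          partial_deriv (game_map own \<theta> v) w x \<le> 0"
    and different_groups: "\<And>x v w. x \<in> cbox l u \<Longrightarrow> v \<noteq> w \<Longrightarrow>
          (v \<in> G1 \<and> w \<in> G2) \<or> (v \<in> G2 \<and> w \<in> G1) \<Longrightarrow>
          partial_deriv (game_map own \<theta> v) w x \<ge> 0"
    and start: "x0 = (\<chi> v. if v \<in> G1 then l $ v else u $ v)"
    and h_pos: "h > 0"
    and all_move: "\<And>k \<nu>. \<nu> \<in> (\<Union>t\<in>{k..k+h}. J t)"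
  shows "(\<forall>x xh k.
            x 0 = x0 \<and> jacobi_run own l u \<theta> J x xh k \<and>
            (\<forall>j<k. \<forall>\<nu>\<in>J j. monotone_move own G1 G2 \<nu> (x j) (xh j \<nu>)) \<longrightarrow>
            (\<forall>\<nu>\<in>J k. \<exists>y\<in>best_responses own l u \<theta> \<nu> (x k). monotone_move own G1 G2 \<nu> (x k) y)) \<and>
         (\<forall>x xh.
            x 0 = x0 \<and>
            (\<forall>k. (\<forall>j\<le>k. \<not> discrete_equilibrium own l u \<theta> (x j)) \<longrightarrow>
                 jacobi_step own l u \<theta> J x xh k \<and>
                 (\<forall>\<nu>\<in>J k. monotone_move own G1 G2 \<nu> (x k) (xh k \<nu>))) \<longrightarrow>
            (\<exists>K. jacobi_run own l u \<theta> J x xh K \<and> discrete_equilibrium own l u \<theta> (x K)))"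
proof -
  define s :: "'v \<Rightarrow> real" where "s v = (if v \<in> G1 then 1 else - 1)" for v
  have s1: "\<bar>s v\<bar> = 1" for v
    by (simp add: s_def)
  have G2: "v \<in> G2 \<longleftrightarrow> v \<notin> G1" for v
    using groups by blast
  have di: "decreasing_increments s l u (\<theta> \<nu>) {v. own v = \<nu>}" for \<nu>
  proof (rule decreasing_increments_from_partials)
    fix x v w
    assume x: "x \<in> cbox l u" and v: "v \<in> {v. own v = \<nu>}" and w: "w \<noteq> v"
    have F: "game_map own \<theta> v = partial_deriv (\<theta> \<nu>) v"
      using v by (auto simp: game_map_def)
    show "partially_differentiable (partial_deriv (\<theta> \<nu>) v) w x"
      using partials_exist[OF x, of v w] w F by auto
    show "s w * (s v * partial_deriv (partial_deriv (\<theta> \<nu>) v) w x) \<le> 0"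
      using same_group[OF x, of v w] different_groups[OF x, of v w] w
      by (auto simp: s_def G2 F)
  qed (use s1 continuously_differentiable_partially[OF C1] in auto)
  have move_iff: "monotone_move own G1 G2 \<nu> a b \<longleftrightarrow>
      (\<forall>v. own v = \<nu> \<longrightarrow> s v * a $ v \<le> s v * b $ v)" for \<nu> a b
    by (auto simp: monotone_move_def s_def G2)
  have least: "s v * x0 $ v \<le> s v * y $ v" if "y \<in> feasible_strategies own l u (own v)" for v y
    using that by (auto simp: start s_def feasible_strategies_def)
  have x0: "x0 \<in> cbox l u \<inter> integer_points"
    using integer_bounds nonempty
    by (auto simp: start mem_box_cart integer_points_def interval_ne_empty_cart)

  have in_box: "x k \<in> cbox l u \<inter> integer_points"
    if "x 0 = x0" "\<And>j. j < k \<Longrightarrow> jacobi_step own l u \<theta> J x xh j" for x xh k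
    using that(2)
  proof (induction k)
    case 0
    show ?case using that(1) x0 by simp
  next
    case (Suc k)
    then show ?case by (metis jacobi_step_in_integer_box less_SucI lessI)
  qed
  have increasing: "signed_le s (x j) (x (Suc j))"
    if "jacobi_step own l u \<theta> J x xh j" "\<forall>\<nu>\<in>J j. monotone_move own G1 G2 \<nu> (x j) (xh j \<nu>)"
    for x xh j
    using that by (intro jacobi_step_signed_le) (auto simp: move_iff)

  have "\<exists>y\<in>best_responses own l u \<theta> \<nu> (x k). monotone_move own G1 G2 \<nu> (x k) y"
    if init: "x 0 = x0" and run: "jacobi_run own l u \<theta> J x xh k"
      and mono: "\<forall>j<k. \<forall>\<nu>\<in>J j. monotone_move own G1 G2 \<nu> (x j) (xh j \<nu>)" for x xh k \<nu>
  proof -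
    have steps: "jacobi_step own l u \<theta> J x xh j" if "j < k" for j
      using run that by (simp add: jacobi_run_def)
    have xk: "x k \<in> cbox l u \<inter> integer_points"
      using in_box[of x, OF init] steps by blast
    consider (untouched) "\<forall>v. own v = \<nu> \<longrightarrow> x k $ v = x 0 $ v"
      | (moved) j where "j < k" "x k \<in> best_responses own l u \<theta> \<nu> (x j)"
      using block_untouched_or_best_response[of k own l u \<theta> J x xh \<nu>] steps by blast
    then show ?thesis
    proof cases
      case untouched
      obtain y where y: "y \<in> best_responses own l u \<theta> \<nu> (x k)"
        using best_response_exists[OF xk] by blast
      then have "monotone_move own G1 G2 \<nu> (x k) y"
        using untouched init least by (auto simp: move_iff best_responses_def)
      with y show ?thesis by blast
    next
      case moved
      have "x j \<in> cbox l u \<inter> integer_points"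
        by (rule in_box[of x, OF init]) (use steps moved(1) less_trans in blast)
      moreover have "signed_le s (x j) (x k)"
        by (rule signed_le_chain) (use increasing[OF steps] mono moved(1) in auto)
      ultimately show ?thesis
        using best_response_above[OF di xk _ _ moved(2)] by (simp add: move_iff)
    qed
  qed
  moreover have "\<exists>K. jacobi_run own l u \<theta> J x xh K \<and> discrete_equilibrium own l u \<theta> (x K)"
    if init: "x 0 = x0"
      and follows: "\<forall>k. (\<forall>j\<le>k. \<not> discrete_equilibrium own l u \<theta> (x j)) \<longrightarrow>
                 jacobi_step own l u \<theta> J x xh k \<and>
                 (\<forall>\<nu>\<in>J k. monotone_move own G1 G2 \<nu> (x k) (xh k \<nu>))" for x xh
  proof -
    have "\<exists>K. discrete_equilibrium own l u \<theta> (x K)"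
    proof (rule ccontr)
      assume never: "\<nexists>K. discrete_equilibrium own l u \<theta> (x K)"
      then have step: "jacobi_step own l u \<theta> J x xh k"
        and "\<forall>\<nu>\<in>J k. monotone_move own G1 G2 \<nu> (x k) (xh k \<nu>)" for k
        using follows by auto
      then have le: "signed_le s (x k) (x (Suc k))" for k
        using increasing by blast
      have box: "x k \<in> cbox l u \<inter> integer_points" for k
        using in_box[of x, OF init] step by blast
      have "finite (range x)"
        by (rule finite_subset[OF _ finite_integer_box[of l u]]) (use box in blast)
      moreover have "s v \<noteq> 0" for v
        by (simp add: s_def)
      ultimately obtain k where k: "\<And>m. m \<ge> k \<Longrightarrow> x m = x k"
        using increasing_sequence_eventually_constant[of s x] le by blast
      have "\<exists>t. \<nu> \<in> J t \<and> jacobi_step own l u \<theta> J x xh t \<and> x t = x k \<and> x (Suc t) = x k" for \<nu>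
      proof -
        obtain t where "t \<ge> k" "\<nu> \<in> J t"
          using all_move[of \<nu> k] by auto
        then show ?thesis
          using step k[of t] k[of "Suc t"] by auto
      qed
      then have "discrete_equilibrium own l u \<theta> (x k)"
        by (rule constant_window_equilibrium[OF box])
      with never show False by blast
    qed
    (* The method stops at the first equilibrium it meets. *)
    then obtain K where K: "discrete_equilibrium own l u \<theta> (x K)"
      and first: "\<And>j. j < K \<Longrightarrow> \<not> discrete_equilibrium own l u \<theta> (x j)"
      unfolding exists_least_iff[of "\<lambda>K. discrete_equilibrium own l u \<theta> (x K)"] by blast
    have "jacobi_run own l u \<theta> J x xh K"
      unfolding jacobi_run_def
    proof (intro conjI allI impI)
      show "x 0 \<in> cbox l u \<inter> integer_points"
        using init x0 by simp
      show "\<not> discrete_equilibrium own l u \<theta> (x k)" if "k < K" for k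
        by (rule first[OF that])
      show "jacobi_step own l u \<theta> J x xh k" if "k < K" for k
        using follows first that by (meson le_less_trans)
    qed
    with K show ?thesis by blast
  qed
  ultimately show ?thesis by blast
qed

end
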